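(* Every finite $5$-centralizer group is super integral; that is, if $G$ is a finite group with exactly $5$ distinct element centralizers, then $G$ is super integral.
   Context: For a group $G$ and $x\in G$ let $C_G(x)=\{y\in G: xy=yx\}$; $G$ is called an $n$-centralizer group if $|\{C_G(x): x\in G\}|=n$. The commuting graph $\Gamma_G$ of a finite non-abelian group $G$ with center $Z(G)$ is the simple undirected graph with vertex set $G\setminus Z(G)$ in which two distinct vertices $x,y$ are adjacent if and only if $xy=yx$. Let $A$ be the adjacency matrix and $D$ the (diagonal) degree matrix of $\Gamma_G$. A finite non-abelian group $G$ is called super integral if all eigenvalues of $A$, all eigenvalues of the Laplacian matrix $D-A$, and all eigenvalues of the signless Laplacian matrix $D+A$ are integers. *)

theory Defs
  imports
    "HOL-Algebra.Group"
    "Graph_Theory.Pair_Digraph"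
    "Jordan_Normal_Form.Char_Poly"
begin

definition centralizer :: "('a, 'b) monoid_scheme \<Rightarrow> 'a \<Rightarrow> 'a set" where
  "centralizer G x = {y \<in> carrier G. x \<otimes>\<^bsub>G\<^esub> y = y \<otimes>\<^bsub>G\<^esub> x}"

definition group_center :: "('a, 'b) monoid_scheme \<Rightarrow> 'a set" where
  "group_center G = {z \<in> carrier G. \<forall>x \<in> carrier G. z \<otimes>\<^bsub>G\<^esub> x = x \<otimes>\<^bsub>G\<^esub> z}"

definition n_centralizer_group :: "nat \<Rightarrow> ('a, 'b) monoid_scheme \<Rightarrow> bool" where
  "n_centralizer_group n G \<longleftrightarrow>
     group G \<and> finite (centralizer G ` carrier G) \<and> card (centralizer G ` carrier G) = n"

text \<open>A simple undirected graph is represented, as in the locale \<^locale>\<open>pair_graph\<close>, by the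
  symmetric irreflexive set of ordered pairs of adjacent vertices.\<close>

definition commuting_graph :: "('a, 'b) monoid_scheme \<Rightarrow> 'a pair_pre_digraph" where
  "commuting_graph G =
     (let V = carrier G - group_center G
      in \<lparr> pverts = V,
           parcs = {(x, y). x \<in> V \<and> y \<in> V \<and> x \<noteq> y \<and> x \<otimes>\<^bsub>G\<^esub> y = y \<otimes>\<^bsub>G\<^esub> x} \<rparr>)"

lemma pair_graph_commuting_graph:
  assumes "finite (carrier G)"
  shows "pair_graph (commuting_graph G)"
proof -
  have "finite (parcs (commuting_graph G))"
    by (rule finite_subset[of _ "carrier G \<times> carrier G"])
       (auto simp: commuting_graph_def Let_def assms)
  then show ?thesis
    by unfold_locales (auto simp: commuting_graph_def Let_def symmetric_def sym_def assms)
qed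

text \<open>The list \<open>vs\<close> enumerates the vertices and fixes the order of rows and columns.\<close>

definition adjacency_matrix :: "'a pair_pre_digraph \<Rightarrow> 'a list \<Rightarrow> complex mat" where
  "adjacency_matrix \<Gamma> vs =
     mat (length vs) (length vs) (\<lambda>(i, j). if (vs ! i, vs ! j) \<in> parcs \<Gamma> then 1 else 0)"

text \<open>In a symmetric digraph the out-degree is the number of neighbours.\<close>

definition degree_matrix :: "'a pair_pre_digraph \<Rightarrow> 'a list \<Rightarrow> complex mat" where
  "degree_matrix \<Gamma> vs =
     mat (length vs) (length vs)
       (\<lambda>(i, j). if i = j then of_nat (out_degree (with_proj \<Gamma>) (vs ! i)) else 0)"

definition laplacian_matrix :: "'a pair_pre_digraph \<Rightarrow> 'a list \<Rightarrow> complex mat" where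
  "laplacian_matrix \<Gamma> vs = degree_matrix \<Gamma> vs - adjacency_matrix \<Gamma> vs"

definition signless_laplacian_matrix :: "'a pair_pre_digraph \<Rightarrow> 'a list \<Rightarrow> complex mat" where
  "signless_laplacian_matrix \<Gamma> vs = degree_matrix \<Gamma> vs + adjacency_matrix \<Gamma> vs"

definition integral_spectrum :: "complex mat \<Rightarrow> bool" where
  "integral_spectrum M \<longleftrightarrow> (\<forall>k. eigenvalue M k \<longrightarrow> k \<in> \<int>)"

text \<open>The spectra do not depend on the enumeration \<open>vs\<close> (another one conjugates the matrices by a
  permutation matrix), so the definition asks for every enumeration. As \<open>carrier G\<close> is finite,
  enumerations exist.\<close>

definition super_integral :: "('a, 'b) monoid_scheme \<Rightarrow> bool" where
  "super_integral G \<longleftrightarrow>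
     group G \<and> finite (carrier G) \<and> \<not> comm_group G \<and>
     (\<forall>vs. distinct vs \<and> set vs = pverts (commuting_graph G) \<longrightarrow>
        integral_spectrum (adjacency_matrix (commuting_graph G) vs) \<and>
        integral_spectrum (laplacian_matrix (commuting_graph G) vs) \<and>
        integral_spectrum (signless_laplacian_matrix (commuting_graph G) vs))"

end

theory Submission
  imports Defs
begin

text \<open>If a non-central \<open>x\<close> commutes with two elements \<open>y\<close>, \<open>z\<close> that do not commute, then the
  centralizers of \<open>1, x, y, z, yz\<close> are pairwise distinct. In a 5-centralizer group there are no
  others; but all five contain \<open>x\<close>, so \<open>x\<close> would be central. Hence non-central elements commute
  exactly if their centralizers agree, and the commuting graph is a disjoint union of cliques. On a
  clique each of the three matrices acts as \<open>v\<^sub>i \<mapsto> a v\<^sub>i + b \<Sum>\<^sub>j v\<^sub>j\<close> with integers \<open>a\<close>, \<open>b\<close>, so an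
  eigenvalue is \<open>a\<close> or \<open>a + b m\<close>, where \<open>m\<close> is the size of the clique.\<close>

lemma (in group) commute_of_common_noncentral:
  assumes n5: "n_centralizer_group 5 G"
    and x: "x \<in> carrier G" "x \<notin> group_center G"
    and y: "y \<in> carrier G" "x \<otimes> y = y \<otimes> x"
    and z: "z \<in> carrier G" "x \<otimes> z = z \<otimes> x"
  shows "y \<otimes> z = z \<otimes> y"
proof (rule ccontr)
  assume nc: "y \<otimes> z \<noteq> z \<otimes> y"
  let ?C = "centralizer G"
  let ?F = "{?C \<one>, ?C x, ?C y, ?C z, ?C (y \<otimes> z)}"
  have mem: "w \<in> ?C u \<longleftrightarrow> w \<in> carrier G \<and> u \<otimes> w = w \<otimes> u" for u w
    by (auto simp: centralizer_def)
  obtain t where t: "t \<in> carrier G" "x \<otimes> t \<noteq> t \<otimes> x"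
    using x by (auto simp: group_center_def)
  \<comment> \<open>If \<open>y\<close> commuted with \<open>y \<otimes> z\<close>, cancelling
    \<open>y\<close> on the left would give \<open>y \<otimes> z = z \<otimes> y\<close>; for
    \<open>z\<close>, cancel on the right.\<close>
  have yz_y: "y \<notin> ?C (y \<otimes> z)"
    using nc y(1) z(1) by (simp add: mem m_assoc)
  have yz_z: "z \<notin> ?C (y \<otimes> z)"
    using nc y(1) z(1) by (simp add: mem m_assoc[symmetric])
  have one: "?C \<one> = carrier G"
    by (auto simp: mem)
  have "t \<notin> ?C x" "y \<in> ?C x" "z \<in> ?C x" "y \<in> ?C y" "z \<notin> ?C y" "z \<in> ?C z" "y \<notin> ?C z"
    using nc t y z by (auto simp: mem)
  \<comment> \<open>Of the ten pairs, \<open>t\<close> separates the first; each of the others is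
    separated by \<open>y\<close> or \<open>z\<close>.\<close>
  then have "?C \<one> \<noteq> ?C x" "?C \<one> \<noteq> ?C y" "?C \<one> \<noteq> ?C z" "?C \<one> \<noteq> ?C (y \<otimes> z)" "?C x \<noteq> ?C y"
      "?C x \<noteq> ?C z" "?C x \<noteq> ?C (y \<otimes> z)" "?C y \<noteq> ?C z" "?C y \<noteq> ?C (y \<otimes> z)" "?C z \<noteq> ?C (y \<otimes> z)"
    using yz_y yz_z t(1) y(1) z(1) one by blast+
  then have "card ?F = 5"
    by simp
  moreover have "?F \<subseteq> ?C ` carrier G"
    using x y z by auto
  ultimately have F: "?F = ?C ` carrier G"
    using n5 by (intro card_subset_eq) (auto simp: n_centralizer_group_def)
  have "x \<otimes> (y \<otimes> z) = y \<otimes> z \<otimes> x"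
    using x(1) y z by (metis m_assoc)
  \<comment> \<open>\<open>x\<close> commutes with each of the five elements whose centralizers form
    \<open>?F\<close>. Since \<open>?F\<close> is exhaustive, this also covers the centralizer of
    \<open>t\<close>, which was chosen not to commute with \<open>x\<close>.\<close>
  then have "x \<in> U" if "U \<in> ?F" for U
    using that x(1) y z by (auto simp: mem)
  moreover have "?C t \<in> ?F"
    unfolding F using t(1) by (rule imageI)
  ultimately have "x \<in> ?C t" .
  then show False
    using t by (simp add: mem)
qed

text \<open>If \<open>x\<close> and \<open>y\<close> commute, anything commuting with one of them
  shares it as a non-central common neighbour with the other, so it commutes with both.\<close>

lemma (in group) commute_iff_centralizer_eq:
  assumes "n_centralizer_group 5 G"
    and "x \<in> carrier G - group_center G" "y \<in> carrier G - group_center G"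
  shows "x \<otimes> y = y \<otimes> x \<longleftrightarrow> centralizer G x = centralizer G y"
proof
  assume xy: "x \<otimes> y = y \<otimes> x"
  have "y \<otimes> w = w \<otimes> y \<longleftrightarrow> x \<otimes> w = w \<otimes> x" if "w \<in> carrier G" for w
    using commute_of_common_noncentral[OF assms(1), of x y w]
      commute_of_common_noncentral[OF assms(1), of y x w] assms(2,3) xy that by auto
  then show "centralizer G x = centralizer G y"
    by (auto simp: centralizer_def)
next
  assume "centralizer G x = centralizer G y"
  moreover have "y \<in> centralizer G y"
    using assms(3) by (simp add: centralizer_def)
  ultimately show "x \<otimes> y = y \<otimes> x"
    by (auto simp: centralizer_def)
qed

lemma (in group) not_comm_if_n_centralizer_group:
  assumes "n_centralizer_group n G" "n \<noteq> 1"
  shows "\<not> comm_group G"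
proof
  assume "comm_group G"
  then interpret comm_group G .
  have "centralizer G x = carrier G" if "x \<in> carrier G" for x
    using that by (auto simp: centralizer_def m_comm)
  then have "centralizer G ` carrier G = {carrier G}"
    by (force simp: image_iff)
  then show False
    using assms by (simp add: n_centralizer_group_def)
qed

text \<open>Sorting the indices by \<open>cls\<close> makes \<open>M\<close> block diagonal with
  blocks a I + b J, where J is the all-ones matrix. \<open>b\<close> is common to all blocks, but
  \<open>a\<close> may vary with the class, as vertex degrees do.\<close>

lemma integral_spectrum_clique_blocks:
  fixes M :: "complex mat" and cls :: "nat \<Rightarrow> 'c"
  assumes M: "M \<in> carrier_mat n n"
    and entry: "\<And>i j. i < n \<Longrightarrow> j < n \<Longrightarrow>
      M $$ (i, j) = (if cls i = cls j then b else 0) + (if i = j then a (cls i) else 0)"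
    and ints: "b \<in> \<int>" "\<And>c. a c \<in> \<int>"
  shows "integral_spectrum M"
  unfolding integral_spectrum_def
proof (intro allI impI)
  fix k assume "eigenvalue M k"
  then obtain v where v: "v \<in> carrier_vec n" "v \<noteq> 0\<^sub>v n" and Mv: "M *\<^sub>v v = k \<cdot>\<^sub>v v"
    using M by (auto simp: eigenvalue_def eigenvector_def)
  \<comment> \<open>One block on which the eigenvector does not vanish determines
    \<open>k\<close>.\<close>
  obtain i where i: "i < n" "v $ i \<noteq> 0"
    using v by (metis carrier_vecD eq_vecI index_zero_vec)
  define B where "B = {j \<in> {..<n}. cls j = cls i}"
  define S where "S = (\<Sum>j\<in>B. v $ j)"
  have eq: "a (cls i) * v $ j + b * S = k * v $ j" if "j \<in> B" for j
  proof -
    have j: "j < n" "cls j = cls i"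
      using that by (auto simp: B_def)
    have "k * v $ j = (M *\<^sub>v v) $ j"
      using j v Mv by simp
    also have "\<dots> = (\<Sum>l<n. M $$ (j, l) * v $ l)"
      using j v M by (simp add: scalar_prod_def lessThan_atLeast0)
    also have "\<dots> = (\<Sum>l<n. (if cls l = cls i then b * v $ l else 0) + (if j = l then a (cls i) * v $ l else 0))"
      using j by (intro sum.cong) (auto simp: entry algebra_simps)
    also have "\<dots> = b * S + a (cls i) * v $ j"
      using j unfolding S_def B_def sum_distrib_left sum.inter_filter[OF finite_lessThan]
      by (auto simp: sum.distrib intro!: sum.cong)
    finally show ?thesis by simp
  qed
  show "k \<in> \<int>"
  proof (cases "S = 0")
    \<comment> \<open>Row \<open>i\<close> now reads \<open>a (cls i) * v $ i = k * v $ i\<close>,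
      and \<open>v $ i\<close> is non-zero.\<close>
    case True
    then have "k = a (cls i)"
      using eq[of i] i by (simp add: B_def)
    then show ?thesis using ints by simp
  next
    case False
    \<comment> \<open>Adding up the rows of the block leaves a multiple of \<open>S\<close>, which
      can be cancelled.\<close>
    have "(\<Sum>j\<in>B. a (cls i) * v $ j + b * S) = (\<Sum>j\<in>B. k * v $ j)"
      using eq by (intro sum.cong) auto
    then have "a (cls i) * S + of_nat (card B) * (b * S) = k * S"
      by (simp add: sum.distrib S_def flip: sum_distrib_left)
    then have "(a (cls i) + b * of_nat (card B)) * S = k * S"
      by (simp only: algebra_simps)
    then have "k = a (cls i) + b * of_nat (card B)"
      using False by simp
    then show ?thesis using ints by simp
  qed
qed

theorem theorem3p3:
  fixes G :: "('a, 'b) monoid_scheme"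
  assumes "group G" and "finite (carrier G)" and "n_centralizer_group 5 G"
  shows "super_integral G"
proof -
  interpret group G by fact
  let ?\<Gamma> = "commuting_graph G"
  let ?C = "centralizer G"
  define V where "V = carrier G - group_center G"
  define m where "m c = card {y \<in> V. ?C y = c}" for c
  have arc: "(x, y) \<in> parcs ?\<Gamma> \<longleftrightarrow> ?C x = ?C y \<and> x \<noteq> y" if "x \<in> V" "y \<in> V" for x y
    using that commute_iff_centralizer_eq[OF assms(3)]
    by (auto simp: commuting_graph_def V_def Let_def)
  \<comment> \<open>A vertex is adjacent to its whole class except itself. Subtracting in the
    complex numbers avoids truncation.\<close>
  have deg: "of_nat (out_degree (with_proj ?\<Gamma>) x) = (of_nat (m (?C x)) - 1 :: complex)"
    if x: "x \<in> V" for x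
  proof -
    have "out_arcs (with_proj ?\<Gamma>) x = Pair x ` ({y \<in> V. ?C y = ?C x} - {x})"
      using x arc[OF x] by (auto simp: out_arcs_def) (auto simp: commuting_graph_def V_def Let_def)
    then have "out_degree (with_proj ?\<Gamma>) x = card ({y \<in> V. ?C y = ?C x} - {x})"
      by (simp add: out_degree_def card_image inj_on_def)
    moreover have "x \<in> {y \<in> V. ?C y = ?C x}" "finite {y \<in> V. ?C y = ?C x}"
      using x assms(2) by (auto simp: V_def)
    ultimately show ?thesis
      unfolding m_def using card_Suc_Diff1 by (metis add_diff_cancel_left' of_nat_Suc)
  qed
  have "integral_spectrum (adjacency_matrix ?\<Gamma> vs) \<and> integral_spectrum (laplacian_matrix ?\<Gamma> vs) \<and>
      integral_spectrum (signless_laplacian_matrix ?\<Gamma> vs)"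
    if vs: "distinct vs" "set vs = pverts ?\<Gamma>" for vs
  proof -
    have inV: "vs ! i \<in> V" if "i < length vs" for i
      using vs(2) nth_mem[OF that] by (simp add: commuting_graph_def V_def Let_def)
    note entry_simps = adjacency_matrix_def laplacian_matrix_def signless_laplacian_matrix_def
      degree_matrix_def arc deg inV nth_eq_iff_index_eq[OF vs(1)]
    note blocks = integral_spectrum_clique_blocks[where n = "length vs" and cls = "\<lambda>i. ?C (vs ! i)"]
    \<comment> \<open>In each case \<open>b\<close> is the entry between distinct vertices of a
      clique, and \<open>a\<close> is the diagonal entry minus \<open>b\<close>. The diagonal
      entries are 0 for the adjacency matrix and \<open>m c - 1\<close> for the other two.\<close>
    have "integral_spectrum (adjacency_matrix ?\<Gamma> vs)"
      by (rule blocks[where a = "\<lambda>_. -1" and b = 1]) (auto simp: entry_simps)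
    moreover have "integral_spectrum (laplacian_matrix ?\<Gamma> vs)"
      by (rule blocks[where a = "\<lambda>c. of_nat (m c)" and b = "-1"]) (auto simp: entry_simps)
    moreover have "integral_spectrum (signless_laplacian_matrix ?\<Gamma> vs)"
      by (rule blocks[where a = "\<lambda>c. of_nat (m c) - 2" and b = 1]) (auto simp: entry_simps)
    ultimately show ?thesis by blast
  qed
  then show ?thesis
    using assms not_comm_if_n_centralizer_group[OF assms(3)] by (simp add: super_integral_def)
qed

end
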